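(* Let $n\geq 2$, $p>0$, and let $f\in C_0(\mathbb{Z}^n)$ be nonnegative with $\|f\|_p=1$. Then $$\left(\frac1n+\frac1p-1\right)\sum_{z\in\mathbb{Z}^n}f(z)^p\log f(z)^p\leq\log\left(\frac{1}{2n}\|df\|_1\right).$$ Moreover, equality holds if and only if $f=|Q|^{-\frac1p}\chi_Q$ for some cube $Q$ in $\mathbb{Z}^n$.
   Context: $C_0(\mathbb{Z}^n)$ denotes the space of real-valued functions on $\mathbb{Z}^n$ with finite support. For $q>0$ and $f\in C_0(\mathbb{Z}^n)$, $\|f\|_q:=\left(\sum_{z\in\mathbb{Z}^n}|f(z)|^q\right)^{1/q}$. $\mathbb{Z}^n$ is regarded as a graph with edge set $E(\mathbb{Z}^n)=\{\{z,z+e_i\} : z\in\mathbb{Z}^n,\ i=1,\dots,n\}$, where $e_i\in\mathbb{Z}^n$ is the vector whose $i$-th component is $1$ and whose other components are $0$. The differential of $f$ is $df(x,y)=f(y)-f(x)$ if $\{x,y\}\in E(\mathbb{Z}^n)$ and $0$ otherwise, and $\|df\|_1:=\sum_{\{x,y\}\in E(\mathbb{Z}^n)}|df(x,y)|$, the sum being over unordered edges; equivalently $\|df\|_1=\sum_{i=1}^n\|\partial_i f\|_1$ with $\partial_i f(z)=f(z+e_i)-f(z)$. The convention $0\log 0=0$ is used. $\chi_Q$ is the indicator function of $Q$ and $|Q|$ its cardinality. A cube in $\mathbb{Z}^n$ is a set of the form $Q=\prod_{i=1}^n[a_i,b_i]$ with $a_i,b_i\in\mathbb{Z}$, $a_i\leq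 b_i$, and $|b_i-a_i|$ independent of $i$, where $[a,b]=\{z\in\mathbb{Z} : a\leq z\leq b\}$. *)

theory Defs
  imports "HOL-Analysis.Analysis"
begin

definition finsupp :: "((int ^ 'n) \<Rightarrow> real) set"  (\<open>C\<^sub>0\<close>)
  where "C\<^sub>0 = {f. finite {z. f z \<noteq> 0}}"

text \<open>The norms below are infinite sums in the sense of \<open>infsum\<close>; on \<open>C\<^sub>0\<close> all but finitely many
  terms vanish, so no convergence question arises.\<close>

definition lq_norm :: "real \<Rightarrow> (int ^ 'n \<Rightarrow> real) \<Rightarrow> real"
  where "lq_norm q f = (\<Sum>\<^sub>\<infinity>z. \<bar>f z\<bar> powr q) powr (1 / q)"

definition lattice_edges :: "(int ^ 'n) set set"
  where "lattice_edges = {{z, z + axis i 1} | z i. True}"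

definition differential :: "(int ^ 'n \<Rightarrow> real) \<Rightarrow> int ^ 'n \<Rightarrow> int ^ 'n \<Rightarrow> real"
  where "differential f x y = (if {x, y} \<in> lattice_edges then f y - f x else 0)"

text \<open>The absolute value of the differential does not depend on the orientation of the edge, so it
  is a function of the unordered edge (see \<open>abs_differential_edge\<close>).\<close>

definition abs_differential :: "(int ^ 'n \<Rightarrow> real) \<Rightarrow> (int ^ 'n) set \<Rightarrow> real"
  where "abs_differential f e = (THE r. \<exists>x y. e = {x, y} \<and> r = \<bar>differential f x y\<bar>)"

definition differential_l1_norm :: "(int ^ 'n \<Rightarrow> real) \<Rightarrow> real"
  where "differential_l1_norm f = (\<Sum>\<^sub>\<infinity>e\<in>lattice_edges. abs_differential f e)"

definition is_cube :: "(int ^ 'n) set \<Rightarrow> bool"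
  where "is_cube Q \<longleftrightarrow> (\<exists>a b. (\<forall>i. a $ i \<le> b $ i) \<and>
           (\<forall>i j. \<bar>b $ i - a $ i\<bar> = \<bar>b $ j - a $ j\<bar>) \<and>
           Q = {z. \<forall>i. z $ i \<in> {a $ i..b $ i}})"

lemma abs_differential_edge: "abs_differential f {x, y} = \<bar>differential f x y\<bar>"
  unfolding abs_differential_def
proof (rule the_equality)
  fix r assume "\<exists>x' y'. {x, y} = {x', y'} \<and> r = \<bar>differential f x' y'\<bar>"
  then show "r = \<bar>differential f x y\<bar>"
    by (auto simp: differential_def doubleton_eq_iff insert_commute)
qed auto

lemma inj_lattice_edge: "inj (\<lambda>(i, z :: int ^ 'n). {z, z + axis i 1})"
proof (rule injI, clarify)
  fix i j and z w :: "int ^ 'n"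
  assume eq: "{z, z + axis i 1} = {w, w + axis j 1}"
  then have "(z = w \<and> z + axis i 1 = w + axis j 1) \<or> (z = w + axis j 1 \<and> z + axis i 1 = w)"
    by (simp add: doubleton_eq_iff)
  then show "i = j \<and> z = w"
  proof
    assume "z = w \<and> z + axis i 1 = w + axis j 1"
    then show ?thesis by (auto simp: axis_eq_axis)
  next
    assume *: "z = w + axis j 1 \<and> z + axis i 1 = w"
    then have "(w + axis j 1 + axis i 1) $ j = w $ j" by metis
    then show ?thesis by (auto simp: axis_def split: if_splits)
  qed
qed

lemma differential_l1_norm_eq_sum_partial:
  fixes f :: "int ^ 'n \<Rightarrow> real"
  assumes "f \<in> C\<^sub>0"
  shows "differential_l1_norm f = (\<Sum>i\<in>UNIV. \<Sum>\<^sub>\<infinity>z. \<bar>f (z + axis i 1) - f z\<bar>)"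
proof -
  let ?g = "\<lambda>(i, z :: int ^ 'n). {z, z + axis i 1}"
  let ?h = "\<lambda>(i, z). \<bar>f (z + axis i 1) - f z\<bar>"
  have E: "lattice_edges = range ?g" by (auto simp: lattice_edges_def)
  have h: "abs_differential f (?g p) = ?h p" for p
    by (cases p) (auto simp: abs_differential_edge differential_def lattice_edges_def)
  let ?S = "{z. f z \<noteq> 0}"
  have fin: "finite ?S" using assms by (simp add: finsupp_def)
  let ?T = "(UNIV :: 'n set) \<times> (?S \<union> (\<Union>i. (\<lambda>z. z - axis i 1) ` ?S))"
  have finT: "finite ?T" using fin by auto
  have zero: "?h p = 0" if "p \<notin> ?T" for p
  proof -
    obtain i z where p: "p = (i, z)" by (cases p)
    have "f z = 0" using that p by auto
    moreover have "f (z + axis i 1) = 0"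
    proof (rule ccontr)
      assume "f (z + axis i 1) \<noteq> 0"
      then have "z \<in> (\<lambda>z. z - axis i 1) ` ?S"
        by (intro image_eqI[of _ _ "z + axis i 1"]) auto
      with that p show False by auto
    qed
    ultimately show ?thesis using p by simp
  qed
  have summ: "?h summable_on UNIV"
    using summable_on_cong_neutral[of UNIV ?T ?h ?h] zero finT by auto
  have "differential_l1_norm f = infsum (abs_differential f \<circ> ?g) UNIV"
    unfolding differential_l1_norm_def E by (rule infsum_reindex[OF inj_lattice_edge])
  also have "\<dots> = infsum ?h (UNIV \<times> UNIV)"
    by (intro infsum_cong_neutral) (simp_all add: h)
  also have "\<dots> = (\<Sum>\<^sub>\<infinity>i. \<Sum>\<^sub>\<infinity>z. ?h (i, z))"
    using infsum_Sigma'_banach[of "\<lambda>i z. ?h (i, z)" UNIV "\<lambda>_. UNIV"] summ by (simp add: case_prod_unfold)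
  finally show ?thesis by simp
qed

end

theory Submission
  imports Defs
begin

text \<open>
  Let \<open>\<mu> = f\<^sup>p\<close>, a probability distribution on the support of \<open>f\<close>, let \<open>H\<close> be its entropy and
  \<open>H\<^sub>i\<close> the entropy of the marginal \<open>\<mu>\<^sub>i\<close> obtained by forgetting coordinate \<open>i\<close>. Along every line in
  direction \<open>i\<close> the variation of \<open>f\<close> is at least twice each of its values, so
  \<open>D\<^sub>i = \<parallel>\<partial>\<^sub>i f\<parallel>\<^sub>1 / 2\<close> is at least \<open>E\<^sub>i = \<Sum> \<mu> f / \<mu>\<^sub>i\<close>. Jensen gives \<open>ln E\<^sub>i \<ge> \<Sum> \<mu> ln f + H\<^sub>i\<close>.
  Averaging over \<open>i\<close>, the arithmetic-geometric mean inequality on the left and Han's inequality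
  \<open>\<Sum>\<^sub>i H\<^sub>i \<ge> (n - 1) H\<close> on the right yield the claim.

  In case of equality, equality in Han's inequality makes the support closed under replacing a
  coordinate of one point by that of another, and \<open>D\<^sub>i = E\<^sub>i\<close> forces \<open>f\<close> to be constant on an interval
  of each line that meets the support, and zero elsewhere on that line. Hence \<open>f\<close> is a multiple of
  the indicator of a box, and equality of all \<open>D\<^sub>i\<close> makes the box a cube.
\<close>

section \<open>Jensen's inequality for the logarithm, with its equality case\<close>

text \<open>With \<open>m\<close> the weighted mean, the gap between the two sides is the sum of the
  terms \<open>d u\<close>. Each is nonnegative because \<open>ln t \<le> t - 1\<close>, and
  vanishes only at \<open>t = 1\<close>, that is \<open>x u = m\<close>.\<close>

lemma weighted_ln_jensen:
  fixes w x :: "'a \<Rightarrow> real"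
  assumes "finite S" and w: "\<And>u. u \<in> S \<Longrightarrow> 0 < w u" and x: "\<And>u. u \<in> S \<Longrightarrow> 0 < x u"
    and w1: "sum w S = 1"
  shows "(\<Sum>u\<in>S. w u * ln (x u)) \<le> ln (\<Sum>u\<in>S. w u * x u)"
    and "(\<Sum>u\<in>S. w u * ln (x u)) = ln (\<Sum>u\<in>S. w u * x u) \<Longrightarrow>
         \<forall>u\<in>S. x u = (\<Sum>u\<in>S. w u * x u)"
proof -
  define m where "m = (\<Sum>u\<in>S. w u * x u)"
  define d where "d u = w u * (x u / m - 1 - ln (x u / m))" for u
  have "S \<noteq> {}" using w1 by auto
  then have m: "m > 0" unfolding m_def using assms by (intro sum_pos) auto
  have d0: "d u \<ge> 0" if "u \<in> S" for u
    using ln_le_minus_one[of "x u / m"] x[OF that] w[OF that] m by (simp add: d_def)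
  have "sum d S = (\<Sum>u\<in>S. w u * x u / m - w u - (w u * ln (x u) - w u * ln m))"
  proof (rule sum.cong[OF refl])
    fix u assume "u \<in> S"
    from x[OF this] show "d u = w u * x u / m - w u - (w u * ln (x u) - w u * ln m)"
      using m by (simp add: d_def ln_div right_diff_distrib)
  qed
  also have "\<dots> = ln m - (\<Sum>u\<in>S. w u * ln (x u))"
    using m w1 by (simp add: sum_subtractf sum_distrib_right[symmetric] sum_divide_distrib[symmetric]
      m_def[symmetric])
  finally have sd: "sum d S = ln m - (\<Sum>u\<in>S. w u * ln (x u))" .
  show "(\<Sum>u\<in>S. w u * ln (x u)) \<le> ln (\<Sum>u\<in>S. w u * x u)"
    using sum_nonneg[of S d] d0 sd by (simp add: m_def)
  assume "(\<Sum>u\<in>S. w u * ln (x u)) = ln (\<Sum>u\<in>S. w u * x u)"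
  then have "sum d S = 0" using sd by (simp add: m_def)
  then have z: "\<forall>u\<in>S. d u = 0" using d0 \<open>finite S\<close> by (simp add: sum_nonneg_eq_0_iff)
  have "x u = m" if "u \<in> S" for u
  proof -
    have "ln (x u / m) = x u / m - 1" using z w[OF that] that by (force simp: d_def)
    then have "x u / m = 1" using ln_eq_minus_one[of "x u / m"] x[OF that] m by simp
    then show ?thesis using m by (simp add: field_simps)
  qed
  then show "\<forall>u\<in>S. x u = (\<Sum>u\<in>S. w u * x u)" by (simp add: m_def)
qed

subsection \<open>Han's inequality\<close>

definition vec_upd :: "'a ^ 'n \<Rightarrow> 'n \<Rightarrow> 'a \<Rightarrow> 'a ^ 'n"
  where "vec_upd u i k = (\<chi> j. if j = i then k else u $ j)"

lemma vec_upd_nth [simp]: "vec_upd u i k $ j = (if j = i then k else u $ j)"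
  by (simp add: vec_upd_def)

lemma vec_upd_same [simp]: "vec_upd u i (u $ i) = u"
  by (simp add: vec_eq_iff)

lemma vec_upd_upd [simp]: "vec_upd (vec_upd u i k) i l = vec_upd u i l"
  by (simp add: vec_eq_iff)

text \<open>Replaces projections: marginals stay functions of full vectors, and
  \<open>agree (- {i})\<close> relates the points of one line in direction \<open>i\<close>.\<close>

definition agree :: "'n set \<Rightarrow> 'a ^ 'n \<Rightarrow> 'a ^ 'n \<Rightarrow> bool"
  where "agree A u v \<longleftrightarrow> (\<forall>j\<in>A. u $ j = v $ j)"

lemma agree_refl [simp]: "agree A u u" by (simp add: agree_def)

lemma agree_sym: "agree A u v \<Longrightarrow> agree A v u" by (simp add: agree_def)

lemma agree_cong: "agree A u v \<Longrightarrow> B \<subseteq> A \<Longrightarrow> agree B w u \<longleftrightarrow> agree B w v"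
  by (auto simp: agree_def)

lemma agree_UNIV [simp]: "agree UNIV u v \<longleftrightarrow> u = v"
  by (auto simp: agree_def vec_eq_iff)

lemma agree_compl_upd: "agree (- {i}) z u \<longleftrightarrow> z = vec_upd u i (z $ i)"
  by (auto simp: agree_def vec_eq_iff)

section \<open>Marginals, entropies and strong subadditivity\<close>

locale finite_distribution =
  fixes S :: "('a ^ 'n) set" and \<mu> :: "'a ^ 'n \<Rightarrow> real"
  assumes finite_S: "finite S"
    and mu_pos: "\<And>u. u \<in> S \<Longrightarrow> 0 < \<mu> u"
    and mu_sum: "sum \<mu> S = 1"
begin

definition marginal :: "'n set \<Rightarrow> 'a ^ 'n \<Rightarrow> real"
  where "marginal A z = (\<Sum>w | w \<in> S \<and> agree A w z. \<mu> w)"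

text \<open>The Shannon entropy of the projection to the coordinates in \<open>A\<close>: grouping
  the points of \<open>S\<close> by their projection gives the usual sum.\<close>

definition entropy :: "'n set \<Rightarrow> real"
  where "entropy A = - (\<Sum>z\<in>S. \<mu> z * ln (marginal A z))"

lemma marginal_pos: "z \<in> S \<Longrightarrow> 0 < marginal A z"
  unfolding marginal_def using finite_S mu_pos by (intro sum_pos2[of _ z]) (auto intro: less_imp_le)

lemma marginal_cong: "agree A u v \<Longrightarrow> marginal A u = marginal A v"
  unfolding marginal_def by (simp add: agree_cong[of A u v A])

lemma marginal_UNIV: "z \<in> S \<Longrightarrow> marginal UNIV z = \<mu> z"
proof -
  assume "z \<in> S"
  then have "{w. w \<in> S \<and> w = z} = {z}" by auto
  then show ?thesis by (simp add: marginal_def)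
qed

lemma entropy_empty: "entropy {} = 0"
  by (simp add: entropy_def marginal_def agree_def mu_sum)

text \<open>Since \<open>i \<in> A\<close>, a point \<open>w\<close> counted in
  \<open>marginal A z\<close> fixes coordinate \<open>i\<close> of \<open>z\<close>, hence
  \<open>z\<close> itself on the line through \<open>u\<close>. So \<open>w\<close> is counted at
  most once, and only if that \<open>z\<close> lies in \<open>S\<close>.\<close>

lemma sum_marginal_line:
  assumes "i \<in> A"
  shows "(\<Sum>z | z \<in> S \<and> agree (- {i}) z u. marginal A z)
       = (\<Sum>w | w \<in> S \<and> agree (A - {i}) w u \<and> vec_upd u i (w $ i) \<in> S. \<mu> w)"
proof -
  have "(\<Sum>z | z \<in> S \<and> agree (- {i}) z u. marginal A z)
      = (\<Sum>(z, w)\<in>(SIGMA z:{z \<in> S. agree (- {i}) z u}. {w \<in> S. agree A w z}). \<mu> w)"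
    unfolding marginal_def using finite_S by (subst sum.Sigma) auto
  also have "\<dots> = (\<Sum>w | w \<in> S \<and> agree (A - {i}) w u \<and> vec_upd u i (w $ i) \<in> S. \<mu> w)"
  proof (rule sum.reindex_bij_witness[of _ "\<lambda>w. (vec_upd u i (w $ i), w)" snd])
    fix a assume "a \<in> (SIGMA z:{z \<in> S. agree (- {i}) z u}. {w \<in> S. agree A w z})"
    then obtain z w where a: "a = (z, w)" "z \<in> S" "w \<in> S" "agree (- {i}) z u" "agree A w z"
      by auto
    have "w $ i = z $ i" using a(5) assms by (simp add: agree_def)
    with a(4) have z: "vec_upd u i (w $ i) = z" by (metis agree_compl_upd)
    show "(vec_upd u i (snd a $ i), snd a) = a" using z a(1) by simp
    have "agree (A - {i}) w u" using a(4,5) by (simp add: agree_def)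
    then show "snd a \<in> {w \<in> S. agree (A - {i}) w u \<and> vec_upd u i (w $ i) \<in> S}"
      using a z by simp
    show "\<mu> (snd a) = (case a of (z, w) \<Rightarrow> \<mu> w)" using a by simp
  next
    fix w assume "w \<in> {w \<in> S. agree (A - {i}) w u \<and> vec_upd u i (w $ i) \<in> S}"
    then show "(vec_upd u i (w $ i), w) \<in> (SIGMA z:{z \<in> S. agree (- {i}) z u}. {w \<in> S. agree A w z})"
      by (simp add: agree_def)
  qed simp
  finally show ?thesis .
qed

lemma sum_marginal_line_le:
  assumes "i \<in> A"
  shows "(\<Sum>z | z \<in> S \<and> agree (- {i}) z u. marginal A z) \<le> marginal (A - {i}) u"
  unfolding sum_marginal_line[OF assms] unfolding marginal_def
  using finite_S mu_pos by (intro sum_mono2) (auto intro: less_imp_le)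

lemma sum_marginal_line_less:
  assumes "i \<in> A" and w: "w \<in> S" "agree (A - {i}) w u" "vec_upd u i (w $ i) \<notin> S"
  shows "(\<Sum>z | z \<in> S \<and> agree (- {i}) z u. marginal A z) < marginal (A - {i}) u"
  unfolding sum_marginal_line[OF assms(1)] unfolding marginal_def
  using finite_S mu_pos w by (intro sum_strict_mono2[of _ _ w]) (auto intro: less_imp_le)

text \<open>\<open>marginal (- {i}) z\<close> is expanded over the line through \<open>z\<close>, on
  which \<open>marginal (A - {i})\<close> is constant, and the sums are swapped. For
  \<open>i \<in> A\<close> each inner quotient is then at most 1 by
  \<open>sum_marginal_line_le\<close>.\<close>

lemma sum_marginal_ratio:
  "(\<Sum>z\<in>S. marginal A z * marginal (- {i}) z / marginal (A - {i}) z)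
   = (\<Sum>u\<in>S. \<mu> u * ((\<Sum>z | z \<in> S \<and> agree (- {i}) z u. marginal A z) / marginal (A - {i}) u))"
proof -
  have "(\<Sum>z\<in>S. marginal A z * marginal (- {i}) z / marginal (A - {i}) z)
      = (\<Sum>z\<in>S. \<Sum>u | u \<in> S \<and> agree (- {i}) u z. \<mu> u * marginal A z / marginal (A - {i}) z)"
    by (simp add: marginal_def[of "- {i}"] sum_distrib_left sum_divide_distrib mult.commute)
  also have "\<dots> = (\<Sum>z\<in>S. \<Sum>u | u \<in> S \<and> agree (- {i}) u z. \<mu> u * marginal A z / marginal (A - {i}) u)"
  proof (intro sum.cong refl)
    fix z u assume "u \<in> {u. u \<in> S \<and> agree (- {i}) u z}"
    then have "marginal (A - {i}) z = marginal (A - {i}) u"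
      by (intro marginal_cong) (auto simp: agree_def)
    then show "\<mu> u * marginal A z / marginal (A - {i}) z = \<mu> u * marginal A z / marginal (A - {i}) u"
      by simp
  qed
  also have "\<dots> = (\<Sum>u\<in>S. \<Sum>z | z \<in> S \<and> agree (- {i}) u z. \<mu> u * marginal A z / marginal (A - {i}) u)"
    by (rule sum.swap_restrict[OF finite_S finite_S])
  also have "\<dots> = (\<Sum>u\<in>S. \<mu> u * ((\<Sum>z | z \<in> S \<and> agree (- {i}) z u. marginal A z) / marginal (A - {i}) u))"
    by (simp add: sum_distrib_left sum_divide_distrib agree_def eq_commute)
  finally show ?thesis .
qed

text \<open>The left side is minus the conditional mutual information of coordinate \<open>i\<close>
  and the coordinates outside \<open>A\<close>, given \<open>A - {i}\<close>. It is the mean of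
  \<open>ln (x z)\<close>, bounded through \<open>ln t \<le> t - 1\<close>.\<close>

lemma entropy_gap:
  assumes "i \<in> A"
  shows "entropy UNIV + entropy (A - {i}) - entropy A - entropy (- {i})
       \<le> (\<Sum>z\<in>S. marginal A z * marginal (- {i}) z / marginal (A - {i}) z) - 1"
proof -
  define x where "x z = marginal A z * marginal (- {i}) z / (\<mu> z * marginal (A - {i}) z)" for z
  have "entropy UNIV + entropy (A - {i}) - entropy A - entropy (- {i})
      = (\<Sum>z\<in>S. \<mu> z * ln (marginal A z) + \<mu> z * ln (marginal (- {i}) z)
                - \<mu> z * ln (\<mu> z) - \<mu> z * ln (marginal (A - {i}) z))"
    by (simp add: entropy_def sum.distrib sum_subtractf marginal_UNIV)
  also have "\<dots> = (\<Sum>z\<in>S. \<mu> z * ln (x z))"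
    using mu_pos marginal_pos
    by (intro sum.cong) (simp_all add: x_def ln_div ln_mult less_imp_neq[symmetric] algebra_simps)
  also have "\<dots> \<le> (\<Sum>z\<in>S. \<mu> z * (x z - 1))"
    using mu_pos marginal_pos by (intro sum_mono mult_left_mono ln_le_minus_one) (auto simp: x_def less_imp_le)
  also have "\<dots> = (\<Sum>z\<in>S. marginal A z * marginal (- {i}) z / marginal (A - {i}) z - \<mu> z)"
  proof (rule sum.cong[OF refl])
    fix z assume "z \<in> S"
    from mu_pos[OF this] show "\<mu> z * (x z - 1) = marginal A z * marginal (- {i}) z / marginal (A - {i}) z - \<mu> z"
      by (simp add: x_def field_simps)
  qed
  finally show ?thesis by (simp add: sum_subtractf mu_sum)
qed

lemma entropy_submodular:
  assumes "i \<in> A"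
  shows "entropy UNIV + entropy (A - {i}) \<le> entropy A + entropy (- {i})"
proof -
  have "(\<Sum>u\<in>S. \<mu> u * ((\<Sum>z | z \<in> S \<and> agree (- {i}) z u. marginal A z) / marginal (A - {i}) u))
      \<le> (\<Sum>u\<in>S. \<mu> u * 1)"
    using sum_marginal_line_le[OF assms] marginal_pos mu_pos
    by (intro sum_mono mult_left_mono) (auto simp: less_imp_le)
  with entropy_gap[OF assms] show ?thesis unfolding sum_marginal_ratio by (simp add: mu_sum)
qed

text \<open>The product of the marginals on \<open>{i}\<close> and \<open>- {i}\<close> charges the
  point made of \<open>u\<close> with coordinate \<open>i\<close> from \<open>w\<close>. If this
  point is outside \<open>S\<close>, the line sum through \<open>u\<close> misses the mass of
  \<open>w\<close>, so the ratio sum drops below 1.\<close>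

lemma entropy_strict_subadditive:
  assumes u: "u \<in> S" and w: "w \<in> S" "vec_upd u i (w $ i) \<notin> S"
  shows "entropy UNIV < entropy {i} + entropy (- {i})"
proof -
  have "(\<Sum>u\<in>S. \<mu> u * ((\<Sum>z | z \<in> S \<and> agree (- {i}) z u. marginal {i} z) / marginal ({i} - {i}) u))
      < (\<Sum>u\<in>S. \<mu> u * 1)"
  proof (rule sum_strict_mono_ex1[OF finite_S])
    show "\<forall>u\<in>S. \<mu> u * ((\<Sum>z | z \<in> S \<and> agree (- {i}) z u. marginal {i} z) / marginal ({i} - {i}) u) \<le> \<mu> u * 1"
      using sum_marginal_line_le[of i "{i}"] marginal_pos mu_pos
      by (intro ballI mult_left_mono) (auto simp: less_imp_le)
    have "(\<Sum>z | z \<in> S \<and> agree (- {i}) z u. marginal {i} z) < marginal ({i} - {i}) u"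
      using w by (intro sum_marginal_line_less) (auto simp: agree_def)
    then have "(\<Sum>z | z \<in> S \<and> agree (- {i}) z u. marginal {i} z) / marginal ({i} - {i}) u < 1"
      using marginal_pos[OF u] by (simp add: divide_less_eq_1)
    then show "\<exists>u\<in>S. \<mu> u * ((\<Sum>z | z \<in> S \<and> agree (- {i}) z u. marginal {i} z) / marginal ({i} - {i}) u) < \<mu> u * 1"
      using u mu_pos[OF u] by (intro bexI[of _ u] mult_strict_left_mono)
  qed
  with entropy_gap[of i "{i}"] show ?thesis unfolding sum_marginal_ratio
    by (simp add: mu_sum entropy_empty)
qed

text \<open>Submodularity says that adding coordinate \<open>i\<close> to fewer coordinates raises the entropy by at
  least \<open>entropy UNIV - entropy (- {i})\<close>; the elements of \<open>B\<close> are added to \<open>A\<close> one at a time.\<close>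

lemma entropy_chain:
  fixes B :: "'n set"
  assumes "A \<inter> B = {}"
  shows "entropy A + (\<Sum>i\<in>B. entropy UNIV - entropy (- {i})) \<le> entropy (A \<union> B)"
proof -
  have "finite B" by simp
  then show ?thesis using assms
  proof (induction B)
    case (insert i B)
    then have "(A \<union> insert i B) - {i} = A \<union> B" by auto
    then show ?case using entropy_submodular[of i "A \<union> insert i B"] insert by simp
  qed simp
qed

text \<open>Each summand is the conditional entropy of coordinate \<open>i\<close> given all others;
  the chain starts at the empty set, whose entropy is 0.\<close>

lemma Han_inequality:
  "(\<Sum>i\<in>UNIV. entropy UNIV - entropy (- {i})) \<le> entropy UNIV"
  using entropy_chain[of "{}" UNIV] by (simp add: entropy_empty)

text \<open>Starting the chain at \<open>{i}\<close> leaves only the increment of \<open>i\<close>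
  itself to be lost. A missing exchanged point makes that increment smaller than
  \<open>entropy {i}\<close>, against equality.\<close>

lemma Han_equality_exchange:
  assumes "(\<Sum>i\<in>UNIV. entropy UNIV - entropy (- {i})) = entropy UNIV"
    and "u \<in> S" "w \<in> S"
  shows "vec_upd u i (w $ i) \<in> S"
proof (rule ccontr)
  assume "vec_upd u i (w $ i) \<notin> S"
  then have "entropy UNIV < entropy {i} + entropy (- {i})"
    using assms by (intro entropy_strict_subadditive)
  moreover have "entropy {i} + (\<Sum>j\<in>- {i}. entropy UNIV - entropy (- {j})) \<le> entropy UNIV"
    using entropy_chain[of "{i}" "- {i}"] by simp
  moreover have "(\<Sum>j\<in>UNIV. entropy UNIV - entropy (- {j}))
      = (entropy UNIV - entropy (- {i})) + (\<Sum>j\<in>- {i}. entropy UNIV - entropy (- {j}))"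
    by (subst sum.remove[of _ i]) (auto simp: Compl_eq_Diff_UNIV)
  ultimately show False using assms(1) by simp
qed

end

subsection \<open>Variation along lines and boxes\<close>

lemma abs_diff_le_variation:
  fixes \<phi> :: "int \<Rightarrow> real"
  assumes "x \<le> y"
  shows "\<bar>\<phi> y - \<phi> x\<bar> \<le> (\<Sum>k\<in>{x..<y}. \<bar>\<phi> (k + 1) - \<phi> k\<bar>)"
  using assms
proof (induction y rule: int_ge_induct)
  case (step y)
  then have "{x..<y + 1} = insert y {x..<y}" by auto
  then show ?case using step by simp
qed simp

text \<open>The path is cut at \<open>a\<close>, \<open>m\<close>, \<open>b\<close>. With
  \<open>a = m = b\<close> the bound is twice the value there; distinct points serve the equality
  case, by penalising a deviation at \<open>m\<close>.\<close>

lemma variation_ge_three_points: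
  fixes \<phi> :: "int \<Rightarrow> real"
  assumes "L \<le> a" "a \<le> m" "m \<le> b" "b \<le> R" and "\<phi> L = 0" "\<phi> R = 0"
  shows "\<phi> a + \<bar>\<phi> a - \<phi> m\<bar> + \<bar>\<phi> m - \<phi> b\<bar> + \<phi> b \<le> (\<Sum>k\<in>{L..<R}. \<bar>\<phi> (k + 1) - \<phi> k\<bar>)"
proof -
  let ?V = "\<lambda>x y. \<Sum>k\<in>{x..<y}. \<bar>\<phi> (k + 1) - \<phi> k\<bar>"
  have split: "?V x z = ?V x y + ?V y z" if "x \<le> y" "y \<le> z" for x y z
    using that by (subst ivl_disj_un_two(3)[of x y z, symmetric]) (auto intro!: sum.union_disjoint)
  have "?V L R = ?V L a + ?V a m + ?V m b + ?V b R"
    using assms by (simp add: split[of L a R] split[of a m R] split[of m b R])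
  then show ?thesis
    using assms abs_diff_le_variation[of L a \<phi>] abs_diff_le_variation[of a m \<phi>]
      abs_diff_le_variation[of m b \<phi>] abs_diff_le_variation[of b R \<phi>] by linarith
qed

section \<open>Boxes, their cardinality and their variation in each direction\<close>

definition int_box :: "int ^ 'n \<Rightarrow> int ^ 'n \<Rightarrow> (int ^ 'n) set"
  where "int_box a b = {z. \<forall>i. z $ i \<in> {a $ i..b $ i}}"

lemma bij_betw_int_box: "bij_betw vec_nth (int_box a b) (\<Pi>\<^sub>E i\<in>UNIV. {a $ i..b $ i})"
  by (rule bij_betw_byWitness[of _ "\<lambda>g. \<chi> i. g i"]) (auto simp: int_box_def PiE_def Pi_def extensional_def)

lemma finite_int_box: "finite (int_box a b)"
  using bij_betw_finite[OF bij_betw_int_box[of a b]] by (simp add: finite_PiE)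

lemma card_int_box: "card (int_box a b) = (\<Prod>i\<in>UNIV. nat (b $ i - a $ i + 1))"
  using bij_betw_same_card[OF bij_betw_int_box[of a b]] by (simp add: card_PiE algebra_simps)

lemma vec_upd_plus_axis: "vec_upd u i k + axis i 1 = vec_upd u i (k + 1 :: int)"
  by (simp add: vec_eq_iff axis_def)

text \<open>Each line in direction \<open>i\<close> that meets the box crosses its boundary twice,
  and such lines correspond to the points of a face orthogonal to \<open>i\<close>.\<close>

lemma sum_partial_indicator_box:
  fixes a b :: "int ^ 'n"
  assumes ab: "\<And>i. a $ i \<le> b $ i" and fin: "finite Z"
    and Z: "\<And>z. z \<in> int_box a b \<or> z + axis i 1 \<in> int_box a b \<Longrightarrow> z \<in> Z"
  shows "(\<Sum>z\<in>Z. \<bar>indicator (int_box a b) (z + axis i 1) - indicator (int_box a b) z\<bar>)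
       = 2 * (\<Prod>j\<in>- {i}. real_of_int (b $ j - a $ j + 1))"
proof -
  let ?T = "int_box (vec_upd a i (b $ i)) b"
  let ?B = "int_box (vec_upd a i (a $ i - 1)) (vec_upd b i (a $ i - 1))"
  have shift: "(z + axis i 1) $ j = (if j = i then z $ j + 1 else z $ j)" for z :: "int ^ 'n" and j
    by (simp add: axis_def)
  have split: "z \<in> int_box c d \<longleftrightarrow> c $ i \<le> z $ i \<and> z $ i \<le> d $ i \<and> (\<forall>j. j \<noteq> i \<longrightarrow> c $ j \<le> z $ j \<and> z $ j \<le> d $ j)"
    for z c d :: "int ^ 'n"
    unfolding int_box_def mem_Collect_eq atLeastAtMost_iff by metis
  \<comment> \<open>The edges in direction \<open>i\<close> leaving the box start in its top face, those
    entering it just below its bottom face.\<close>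
  have T: "z \<in> ?T \<longleftrightarrow> z \<in> int_box a b \<and> z + axis i 1 \<notin> int_box a b" for z
    unfolding split shift using ab[of i] by (auto simp del: vector_add_component)
  have B: "z \<in> ?B \<longleftrightarrow> z \<notin> int_box a b \<and> z + axis i 1 \<in> int_box a b" for z
    unfolding split shift using ab[of i] by (auto simp del: vector_add_component)
  \<comment> \<open>Both faces are boxes of thickness one in direction \<open>i\<close>, so only the
    other sides contribute.\<close>
  have card: "real (card (int_box c d)) = (\<Prod>j\<in>- {i}. real_of_int (b $ j - a $ j + 1))"
    if "c $ i = d $ i" "\<And>j. j \<noteq> i \<Longrightarrow> c $ j = a $ j \<and> d $ j = b $ j" for c d :: "int ^ 'n"
  proof -
    have "real (card (int_box c d)) = (\<Prod>j\<in>insert i (- {i}). real (nat (d $ j - c $ j + 1)))"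
      unfolding card_int_box of_nat_prod by (intro prod.cong) auto
    also have "\<dots> = (\<Prod>j\<in>- {i}. real (nat (d $ j - c $ j + 1)))"
      using that(1) by simp
    also have "\<dots> = (\<Prod>j\<in>- {i}. real_of_int (b $ j - a $ j + 1))"
    proof (rule prod.cong[OF refl])
      fix j assume "j \<in> - {i}"
      then show "real (nat (d $ j - c $ j + 1)) = real_of_int (b $ j - a $ j + 1)"
        using that(2)[of j] ab[of j] by simp
    qed
    finally show ?thesis .
  qed
  have "(\<Sum>z\<in>Z. \<bar>indicator (int_box a b) (z + axis i 1) - indicator (int_box a b) z\<bar>)
      = (\<Sum>z\<in>Z. indicator ?T z + indicator ?B z :: real)"
    using T B by (intro sum.cong) (auto simp: indicator_def)
  also have "\<dots> = real (card ?T) + real (card ?B)"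
  proof -
    have "sum (indicator A) Z = real (card A)" if "A \<subseteq> Z" for A
      using fin that by (simp add: indicator_def Int_absorb1)
    moreover have "?T \<subseteq> Z" "?B \<subseteq> Z" using Z T B by blast+
    ultimately show ?thesis by (simp add: sum.distrib)
  qed
  finally show ?thesis by (simp add: card)
qed

text \<open>Counting the side in points makes it the factor that occurs in
  \<open>card_int_box\<close>.\<close>

lemma is_cube_iff_int_box:
  "is_cube Q \<longleftrightarrow> (\<exists>a b m. (\<forall>i. b $ i - a $ i + 1 = int m) \<and> m > 0 \<and> Q = int_box a b)"
proof
  assume "is_cube Q"
  then obtain a b where ab: "\<And>i. a $ i \<le> b $ i" "\<And>i j. \<bar>b $ i - a $ i\<bar> = \<bar>b $ j - a $ j\<bar>" "Q = int_box a b"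
    unfolding is_cube_def int_box_def by blast
  fix k
  have "b $ i - a $ i + 1 = int (nat (b $ k - a $ k + 1))" for i
    using ab(1)[of i] ab(1)[of k] ab(2)[of i k] by simp
  moreover have "nat (b $ k - a $ k + 1) > 0" using ab(1)[of k] by simp
  ultimately show "\<exists>a b m. (\<forall>i. b $ i - a $ i + 1 = int m) \<and> m > 0 \<and> Q = int_box a b"
    using ab(3) by blast
next
  assume "\<exists>a b m. (\<forall>i. b $ i - a $ i + 1 = int m) \<and> m > 0 \<and> Q = int_box a b"
  then obtain a b m where m: "\<And>i. b $ i - a $ i + 1 = int m" "m > 0" "Q = int_box a b" by blast
  have d: "b $ i - a $ i = int m - 1" for i using m(1)[of i] by simp
  have "a $ i \<le> b $ i" for i using d[of i] m(2) by simp
  then show "is_cube Q" unfolding is_cube_def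
    by (intro exI[of _ a] exI[of _ b]) (simp add: d m(3) int_box_def)
qed

subsection \<open>The inequality and its equality case\<close>

text \<open>Support coordinates are strictly below \<open>N\<close> in absolute value, so on each
  line \<open>f\<close> vanishes at both \<open>- N\<close> and \<open>N\<close>, as
  \<open>variation_ge_three_points\<close> requires.\<close>

locale lattice_density =
  fixes f :: "int ^ 'n \<Rightarrow> real" and p :: real and N :: int
  assumes p_pos: "0 < p"
    and f_nonneg: "\<And>z. 0 \<le> f z"
    and f_outside: "\<And>z i. N \<le> \<bar>z $ i\<bar> \<Longrightarrow> f z = 0"
    and f_sum: "(\<Sum>z | 0 < f z. f z powr p) = 1"
begin

definition S where "S = {z. 0 < f z}"

text \<open>The window is asymmetric because it collects lower endpoints of edges: an edge touching
  the support starts at a support point or one unit below it.\<close>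

definition Z :: "(int ^ 'n) set" where "Z = int_box (\<chi> i. - N) (\<chi> i. N - 1)"

lemma f_zero_iff: "f z = 0 \<longleftrightarrow> z \<notin> S"
  using f_nonneg[of z] by (auto simp: S_def)

lemma S_coord: "u \<in> S \<Longrightarrow> \<bar>u $ i\<bar> < N"
  using f_outside[of u i] by (force simp: S_def)

lemma finite_Z: "finite Z" by (simp add: Z_def finite_int_box)

lemma mem_Z: "z \<in> Z \<longleftrightarrow> (\<forall>i. - N \<le> z $ i \<and> z $ i < N)"
  by (auto simp: Z_def int_box_def)

lemma S_subset_Z: "S \<subseteq> Z"
proof
  fix u assume u: "u \<in> S"
  have "- N \<le> u $ i \<and> u $ i < N" for i using S_coord[OF u, of i] by linarith
  then show "u \<in> Z" by (simp add: mem_Z)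
qed

lemma outside_Z:
  assumes "z \<notin> Z"
  shows "z \<notin> S" "z + axis i 1 \<notin> S"
proof -
  obtain j where j: "z $ j < - N \<or> N \<le> z $ j" using assms unfolding mem_Z by (meson not_le_imp_less)
  have "(z + axis i 1) $ j = (if j = i then z $ j + 1 else z $ j)" by (simp add: axis_def)
  \<comment> \<open>A coordinate below \<open>- N\<close> is still at most \<open>- N\<close> after
    the unit shift.\<close>
  then have "N \<le> \<bar>(z + axis i 1) $ j\<bar>" using j by (auto split: if_splits)
  then show "z + axis i 1 \<notin> S" using f_outside f_zero_iff by blast
  show "z \<notin> S" using S_subset_Z assms by blast
qed

sublocale finite_distribution S "\<lambda>z. f z powr p"
proof
  show "finite S" using finite_subset[OF S_subset_Z finite_Z] .
qed (use f_sum in \<open>auto simp: S_def\<close>)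

section \<open>Variation against conditional means, line by line\<close>

definition half_variation :: "'n \<Rightarrow> real"
  where "half_variation i = (\<Sum>z\<in>Z. \<bar>f (z + axis i 1) - f z\<bar>) / 2"

definition line_variation :: "'n \<Rightarrow> int ^ 'n \<Rightarrow> real"
  where "line_variation i u = (\<Sum>z | z \<in> Z \<and> agree (- {i}) z u. \<bar>f (z + axis i 1) - f z\<bar>)"

text \<open>The sum, over the lines in direction \<open>i\<close>, of the mean of \<open>f\<close> conditional on that line.\<close>

definition line_mean_sum :: "'n \<Rightarrow> real"
  where "line_mean_sum i = (\<Sum>u\<in>S. f u powr p * (f u / marginal (- {i}) u))"

lemma line_variation_eq:
  assumes "u \<in> S"
  shows "line_variation i u = (\<Sum>k\<in>{- N..<N}. \<bar>f (vec_upd u i (k + 1)) - f (vec_upd u i k)\<bar>)"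
  unfolding line_variation_def
proof (rule sum.reindex_bij_witness[of _ "\<lambda>k. vec_upd u i k" "\<lambda>z. z $ i"])
  fix z assume z: "z \<in> {z. z \<in> Z \<and> agree (- {i}) z u}"
  then show eq: "vec_upd u i (z $ i) = z" by (metis (mono_tags, lifting) agree_compl_upd mem_Collect_eq)
  show "z $ i \<in> {- N..<N}" using z by (simp add: mem_Z)
  show "\<bar>f (vec_upd u i (z $ i + 1)) - f (vec_upd u i (z $ i))\<bar> = \<bar>f (z + axis i 1) - f z\<bar>"
    using vec_upd_plus_axis[of u i "z $ i"] by (simp add: eq)
next
  fix k assume "k \<in> {- N..<N}"
  then show "vec_upd u i k \<in> {z. z \<in> Z \<and> agree (- {i}) z u}"
    using assms S_subset_Z by (auto simp: mem_Z agree_def)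
qed simp

lemma line_variation_ge:
  assumes "u \<in> S" and "- N \<le> a" "a \<le> m" "m \<le> b" "b \<le> N"
  shows "f (vec_upd u i a) + \<bar>f (vec_upd u i a) - f (vec_upd u i m)\<bar>
       + \<bar>f (vec_upd u i m) - f (vec_upd u i b)\<bar> + f (vec_upd u i b) \<le> line_variation i u"
  unfolding line_variation_eq[OF assms(1)]
proof (rule variation_ge_three_points[of "- N" a m b N "\<lambda>k. f (vec_upd u i k)"])
  show "f (vec_upd u i (- N)) = 0" "f (vec_upd u i N) = 0"
    by (auto intro!: f_outside[of _ i])
qed (use assms in auto)

lemma two_f_le_line_variation: "u \<in> S \<Longrightarrow> 2 * f u \<le> line_variation i u"
  using line_variation_ge[of u "u $ i" "u $ i" "u $ i" i] S_coord[of u i] by simp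

text \<open>On a line meeting the support the weights \<open>f u powr p / marginal (- {i}) u\<close>
  sum to 1, so the average counts the variation of each such line once.\<close>

lemma sum_line_variation_le:
  "(\<Sum>u\<in>S. f u powr p * (line_variation i u / marginal (- {i}) u)) \<le> 2 * half_variation i"
proof -
  let ?d = "\<lambda>z. \<bar>f (z + axis i 1) - f z\<bar>"
  have "(\<Sum>u\<in>S. f u powr p * (line_variation i u / marginal (- {i}) u))
      = (\<Sum>u\<in>S. \<Sum>z | z \<in> Z \<and> agree (- {i}) z u. f u powr p * ?d z / marginal (- {i}) u)"
    by (simp add: line_variation_def sum_distrib_left sum_divide_distrib)
  also have "\<dots> = (\<Sum>u\<in>S. \<Sum>z | z \<in> Z \<and> agree (- {i}) z u. f u powr p * ?d z / marginal (- {i}) z)"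
  proof (intro sum.cong refl)
    fix u z assume "z \<in> {z. z \<in> Z \<and> agree (- {i}) z u}"
    then have "marginal (- {i}) z = marginal (- {i}) u" by (intro marginal_cong) simp
    then show "f u powr p * ?d z / marginal (- {i}) u = f u powr p * ?d z / marginal (- {i}) z"
      by simp
  qed
  also have "\<dots> = (\<Sum>z\<in>Z. \<Sum>u | u \<in> S \<and> agree (- {i}) z u. f u powr p * ?d z / marginal (- {i}) z)"
    by (rule sum.swap_restrict[OF finite_S finite_Z])
  also have "\<dots> = (\<Sum>z\<in>Z. ?d z * (marginal (- {i}) z / marginal (- {i}) z))"
  proof (rule sum.cong[OF refl])
    fix z
    have "marginal (- {i}) z = (\<Sum>u | u \<in> S \<and> agree (- {i}) z u. f u powr p)"
      unfolding marginal_def by (rule sum.cong) (auto intro: agree_sym)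
    then show "(\<Sum>u | u \<in> S \<and> agree (- {i}) z u. f u powr p * ?d z / marginal (- {i}) z)
        = ?d z * (marginal (- {i}) z / marginal (- {i}) z)"
      by (simp only: sum_distrib_right[symmetric] sum_divide_distrib[symmetric]) simp
  qed
  \<comment> \<open>On lines that miss the support the quotient is \<open>0 / 0 = 0\<close>.\<close>
  also have "\<dots> \<le> (\<Sum>z\<in>Z. ?d z)"
    by (intro sum_mono mult_left_le) auto
  finally show ?thesis by (simp add: half_variation_def)
qed

text \<open>Both parts weigh the defects \<open>line_variation i u - 2 * f u\<close>, which are
  nonnegative on \<open>S\<close>: their weighted sum is at most twice the difference of the two
  quantities.\<close>

lemma line_mean_sum_le: "line_mean_sum i \<le> half_variation i"
  and line_mean_sum_eq: "line_mean_sum i = half_variation i \<Longrightarrow> u \<in> S \<Longrightarrow> line_variation i u = 2 * f u"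
proof -
  define g where "g u = f u powr p * ((line_variation i u - 2 * f u) / marginal (- {i}) u)" for u
  have g: "sum g S \<le> 2 * (half_variation i - line_mean_sum i)"
    using sum_line_variation_le[of i]
    by (simp add: g_def line_mean_sum_def diff_divide_distrib right_diff_distrib sum_subtractf
      sum_distrib_left mult.left_commute)
  have g0: "0 \<le> g u" if "u \<in> S" for u
    using two_f_le_line_variation[OF that, of i] marginal_pos[OF that, of "- {i}"] by (simp add: g_def)
  show "line_mean_sum i \<le> half_variation i" using sum_nonneg[of S g] g0 g by simp
  assume "line_mean_sum i = half_variation i" "u \<in> S"
  then have "sum g S = 0" using g sum_nonneg[of S g] g0 by simp
  then have "g u = 0" using g0 finite_S \<open>u \<in> S\<close> by (simp add: sum_nonneg_eq_0_iff)
  then show "line_variation i u = 2 * f u"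
    using mu_pos[OF \<open>u \<in> S\<close>] marginal_pos[OF \<open>u \<in> S\<close>, of "- {i}"] by (simp add: g_def)
qed

lemma f_pos: "u \<in> S \<Longrightarrow> 0 < f u" by (simp add: S_def)

lemma S_nonempty: "S \<noteq> {}" using mu_sum by auto

lemma line_mean_sum_pos: "0 < line_mean_sum i"
  unfolding line_mean_sum_def using finite_S S_nonempty mu_pos f_pos marginal_pos
  by (intro sum_pos) auto

section \<open>The logarithmic inequality in terms of entropies\<close>

text \<open>Jensen with weights \<open>f u powr p\<close>; the term \<open>entropy UNIV / p\<close>
  arises from \<open>ln (f u) = ln (f u powr p) / p\<close>.\<close>

lemma ln_line_mean_sum_ge: "entropy (- {i}) - entropy UNIV / p \<le> ln (line_mean_sum i)"
proof -
  have "entropy (- {i}) - entropy UNIV / p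
      = (\<Sum>u\<in>S. f u powr p * ln (f u) - f u powr p * ln (marginal (- {i}) u))"
    using p_pos f_pos by (simp add: entropy_def sum_subtractf marginal_UNIV ln_powr sum_divide_distrib)
  also have "\<dots> = (\<Sum>u\<in>S. f u powr p * ln (f u / marginal (- {i}) u))"
  proof (rule sum.cong[OF refl])
    fix u assume "u \<in> S"
    from f_pos[OF this] marginal_pos[OF this, of "- {i}"]
    show "f u powr p * ln (f u) - f u powr p * ln (marginal (- {i}) u)
        = f u powr p * ln (f u / marginal (- {i}) u)"
      by (simp add: ln_div right_diff_distrib)
  qed
  also have "\<dots> \<le> ln (line_mean_sum i)"
    unfolding line_mean_sum_def using finite_S mu_pos mu_sum f_pos marginal_pos
    by (intro weighted_ln_jensen(1)) auto
  finally show ?thesis .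
qed

lemma half_variation_pos: "0 < half_variation i"
  using line_mean_sum_pos line_mean_sum_le less_le_trans by blast

text \<open>Multiplied by \<open>n\<close>, the bound is a chain of four links: Han, Jensen in each
  direction, \<open>line_mean_sum_le\<close>, and the arithmetic-geometric mean inequality. Equality
  of the ends forces equality in every link.\<close>

lemma log_sobolev_half_variation:
  fixes n defines "n \<equiv> real CARD('n)"
  shows "(1 / n + 1 / p - 1) * - entropy UNIV \<le> ln (\<Sum>i\<in>UNIV. 1 / n * half_variation i)"
    and "(1 / n + 1 / p - 1) * - entropy UNIV = ln (\<Sum>i\<in>UNIV. 1 / n * half_variation i) \<Longrightarrow>
         (\<Sum>i\<in>UNIV. entropy UNIV - entropy (- {i})) = entropy UNIV
       \<and> (\<forall>i. line_mean_sum i = half_variation i)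
       \<and> (\<forall>i j. half_variation i = half_variation j)"
proof -
  let ?H = "entropy UNIV" and ?A = "\<Sum>i\<in>UNIV. 1 / n * half_variation i"
  let ?G = "\<Sum>i\<in>UNIV. ?H - entropy (- {i})"
  have n: "n > 0" by (simp add: n_def)
  have 1: "?G \<le> ?H" by (rule Han_inequality)
  have ln_le: "ln (line_mean_sum i) \<le> ln (half_variation i)" for i
    using line_mean_sum_pos[of i] half_variation_pos[of i] line_mean_sum_le[of i] by simp
  have "(\<Sum>i\<in>UNIV. entropy (- {i}) - ?H / p) = n * (?H - ?H / p) - ?G"
    by (simp add: sum_subtractf n_def algebra_simps)
  then have 2: "n * (?H - ?H / p) - ?G \<le> (\<Sum>i\<in>UNIV. ln (line_mean_sum i))"
    using sum_mono[of UNIV "\<lambda>i. entropy (- {i}) - ?H / p" "\<lambda>i. ln (line_mean_sum i)"]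
      ln_line_mean_sum_ge by simp
  have 3: "(\<Sum>i\<in>UNIV. ln (line_mean_sum i)) \<le> (\<Sum>i\<in>UNIV. ln (half_variation i))"
    by (intro sum_mono ln_le)
  \<comment> \<open>Jensen with equal weights \<open>1 / n\<close> is the arithmetic-geometric mean
    inequality in logarithmic form.\<close>
  have J: "(\<Sum>i\<in>UNIV. 1 / n * ln (half_variation i)) \<le> ln ?A"
    using half_variation_pos n by (intro weighted_ln_jensen(1)) (auto simp: n_def)
  have 4: "(\<Sum>i\<in>UNIV. ln (half_variation i)) \<le> n * ln ?A"
    using J n by (simp add: sum_divide_distrib[symmetric] field_simps)
  have L: "n * ((1 / n + 1 / p - 1) * - ?H) = n * (?H - ?H / p) - ?H"
    using n p_pos by (simp add: field_simps)
  have "n * ((1 / n + 1 / p - 1) * - ?H) \<le> n * ln ?A" using 1 2 3 4 L by linarith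
  then show "(1 / n + 1 / p - 1) * - ?H \<le> ln ?A" using n by (rule mult_left_le_imp_le)
  assume "(1 / n + 1 / p - 1) * - ?H = ln ?A"
  then have E: "n * (?H - ?H / p) - ?H = n * ln ?A" using L by metis
  have "?G = ?H" using E 1 2 3 4 by linarith
  moreover have "line_mean_sum i = half_variation i" for i
  proof (rule ccontr)
    assume "line_mean_sum i \<noteq> half_variation i"
    then have "ln (line_mean_sum i) < ln (half_variation i)"
      using line_mean_sum_pos[of i] half_variation_pos[of i] line_mean_sum_le[of i] by simp
    then have "(\<Sum>i\<in>UNIV. ln (line_mean_sum i)) < (\<Sum>i\<in>UNIV. ln (half_variation i))"
      using ln_le by (intro sum_strict_mono_ex1) auto
    then show False using E 1 2 4 by linarith
  qed
  moreover have "half_variation i = half_variation j" for i j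
  proof -
    have "(\<Sum>i\<in>UNIV. ln (half_variation i)) = n * ln ?A" using E 1 2 3 4 by linarith
    then have "(\<Sum>i\<in>UNIV. 1 / n * ln (half_variation i)) = ln ?A"
      using n by (simp add: sum_divide_distrib[symmetric])
    then have "\<forall>i\<in>UNIV. half_variation i = ?A"
      by (intro weighted_ln_jensen(2)) (use half_variation_pos n in \<open>simp_all add: n_def\<close>)
    then show ?thesis by (metis UNIV_I)
  qed
  ultimately show "?G = ?H \<and> (\<forall>i. line_mean_sum i = half_variation i)
      \<and> (\<forall>i j. half_variation i = half_variation j)" by blast
qed

section \<open>Shape of the extremal functions\<close>

text \<open>Two support points on a line share its variation, which equality makes twice the value
  at either. The three-point bound then leaves no room for a different value at
  \<open>m\<close>.\<close>

lemma constant_along_lines: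
  assumes eq: "line_mean_sum i = half_variation i" and "vec_upd u i a \<in> S" "vec_upd u i b \<in> S"
    and m: "a \<le> m" "m \<le> b"
  shows "vec_upd u i m \<in> S" "f (vec_upd u i a) = f (vec_upd u i b)"
proof -
  let ?u = "\<lambda>k. vec_upd u i k"
  have ab: "\<bar>a\<bar> < N" "\<bar>b\<bar> < N" using S_coord[OF assms(2), of i] S_coord[OF assms(3), of i] by auto
  have lv: "line_variation i (?u a) = line_variation i (?u b)"
    by (simp add: line_variation_def agree_def)
  have va: "line_variation i (?u a) = 2 * f (?u a)" and vb: "line_variation i (?u b) = 2 * f (?u b)"
    using line_mean_sum_eq[OF eq] assms by auto
  then show fab: "f (?u a) = f (?u b)" using lv by simp
  have "f (?u a) + \<bar>f (?u a) - f (?u m)\<bar> + \<bar>f (?u m) - f (?u b)\<bar> + f (?u b) \<le> 2 * f (?u a)"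
    using line_variation_ge[OF assms(2), of a m b i] ab m va by simp
  then have "f (?u m) = f (?u a)" using fab by linarith
  then show "?u m \<in> S" using assms(2) by (simp add: S_def)
qed

text \<open>The box is the bounding box of the support. Exchange brings the extreme coordinates onto
  each line through a support point, and constancy along lines fills the interval between
  them.\<close>

lemma constant_on_box:
  assumes eq: "\<And>i. line_mean_sum i = half_variation i"
    and exch: "\<And>u w i. u \<in> S \<Longrightarrow> w \<in> S \<Longrightarrow> vec_upd u i (w $ i) \<in> S"
  obtains a b c where "\<And>i. a $ i \<le> b $ i" "S = int_box a b" "\<And>z. f z = c * indicator S z" "0 < c"
proof -
  define a b where "a = (\<chi> i. Min ((\<lambda>u. u $ i) ` S))" and "b = (\<chi> i. Max ((\<lambda>u. u $ i) ` S))"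
  obtain u0 where u0: "u0 \<in> S" using S_nonempty by blast
  have ne: "finite ((\<lambda>u. u $ i) ` S)" "(\<lambda>u. u $ i) ` S \<noteq> {}" for i
    using finite_S S_nonempty by auto
  have ab: "a $ i \<le> u $ i" "u $ i \<le> b $ i" if "u \<in> S" for u i
    using that ne by (auto simp: a_def b_def)
  have wa: "\<exists>w\<in>S. w $ i = a $ i" and wb: "\<exists>w\<in>S. w $ i = b $ i" for i
    using Min_in[OF ne[of i]] Max_in[OF ne[of i]] by (auto simp: a_def b_def)
  \<comment> \<open>\<open>A\<close> collects the coordinates already moved to those of
    \<open>z\<close>; \<open>A = UNIV\<close> puts \<open>z\<close> itself into
    \<open>S\<close>.\<close>
  have fill: "\<exists>u\<in>S. agree A u z" if z: "z \<in> int_box a b" for z A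
  proof -
    have "finite A" by simp
    then show ?thesis
    proof (induction A)
      case empty
      then show ?case using u0 by (auto simp: agree_def)
    next
      case (insert i A)
      then obtain u where u: "u \<in> S" "agree A u z" by blast
      have "vec_upd u i (a $ i) \<in> S" "vec_upd u i (b $ i) \<in> S"
        using exch[OF u(1)] wa[of i] wb[of i] by metis+
      then have "vec_upd u i (z $ i) \<in> S"
        using constant_along_lines(1)[OF eq, of u i "a $ i" "b $ i" "z $ i"] z
        by (simp add: int_box_def)
      moreover have "agree (insert i A) (vec_upd u i (z $ i)) z" using u(2) by (auto simp: agree_def)
      ultimately show ?case by blast
    qed
  qed
  have S: "S = int_box a b"
  proof
    show "S \<subseteq> int_box a b" using ab by (auto simp: int_box_def)
    show "int_box a b \<subseteq> S" using fill[of _ UNIV] by auto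
  qed
  have const: "f w = f u0" if w: "w \<in> S" for w
  proof -
    \<comment> \<open>The walk from \<open>u0\<close> to \<open>w\<close> changes one coordinate at
      a time, stays in \<open>S\<close> by exchange, and keeps the value of
      \<open>f\<close>.\<close>
    have "\<exists>v\<in>S. agree A v w \<and> f v = f u0" for A :: "'n set"
    proof -
      have "finite A" by simp
      then show ?thesis
      proof (induction A)
        case empty
        then show ?case using u0 by (auto simp: agree_def)
      next
        case (insert i A)
        then obtain v where v: "v \<in> S" "agree A v w" "f v = f u0" by blast
        let ?v = "vec_upd v i (w $ i)"
        have vS: "?v \<in> S" using exch v(1) w by blast
        moreover have "f ?v = f v"
        proof (cases "v $ i \<le> w $ i")
          case True
          then show ?thesis using constant_along_lines(2)[OF eq, of v i "v $ i" "w $ i"] v(1) vS by simp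
        next
          case False
          then show ?thesis using constant_along_lines(2)[OF eq, of v i "w $ i" "v $ i" "v $ i"] v(1) vS by simp
        qed
        moreover have "agree (insert i A) ?v w" using v(2) by (auto simp: agree_def)
        ultimately show ?case using v(3) by metis
      qed
    qed
    from this[of UNIV] show ?thesis by simp
  qed
  show ?thesis
  proof (rule that[OF _ S])
    show "a $ i \<le> b $ i" for i using ab[OF u0, of i] by simp
    show "f z = f u0 * indicator S z" for z
      using const f_zero_iff by (auto simp: indicator_def)
    show "0 < f u0" using u0 f_pos by simp
  qed
qed

lemma half_variation_box:
  assumes ab: "\<And>i. a $ i \<le> b $ i" and S: "S = int_box a b" and f: "\<And>z. f z = c * indicator S z" and "0 < c"
  shows "half_variation i = c * (\<Prod>j\<in>- {i}. real_of_int (b $ j - a $ j + 1))"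
proof -
  have "(\<Sum>z\<in>Z. \<bar>f (z + axis i 1) - f z\<bar>)
      = (\<Sum>z\<in>Z. c * \<bar>indicator S (z + axis i 1) - indicator S z\<bar>)"
    using \<open>0 < c\<close> by (simp add: f right_diff_distrib[symmetric] abs_mult)
  also have "\<dots> = c * (2 * (\<Prod>j\<in>- {i}. real_of_int (b $ j - a $ j + 1)))"
    unfolding sum_distrib_left[symmetric] S
    using outside_Z finite_Z unfolding S by (subst sum_partial_indicator_box[OF ab]) blast+
  finally show ?thesis by (simp add: half_variation_def)
qed

section \<open>Translation to the sums of the theorem, and the two directions of the equality
  case\<close>

lemma infsum_entropy: "(\<Sum>\<^sub>\<infinity>z. f z powr p * ln (f z powr p)) = - entropy UNIV"
proof -
  have "(\<Sum>\<^sub>\<infinity>z. f z powr p * ln (f z powr p)) = (\<Sum>\<^sub>\<infinity>z\<in>S. f z powr p * ln (f z powr p))"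
    \<comment> \<open>Off the support \<open>0 powr p = 0\<close>, so the product vanishes in
      accordance with \<open>0 log 0 = 0\<close>.\<close>
    by (rule infsum_cong_neutral) (auto simp: f_zero_iff[symmetric])
  then show ?thesis by (simp add: infsum_finite finite_S entropy_def marginal_UNIV)
qed

lemma differential_l1_norm_eq: "differential_l1_norm f = (\<Sum>i\<in>UNIV. 2 * half_variation i)"
proof -
  have "{z. f z \<noteq> 0} = S" using f_zero_iff by blast
  then have "f \<in> C\<^sub>0" by (simp add: finsupp_def finite_S)
  moreover have "(\<Sum>\<^sub>\<infinity>z. \<bar>f (z + axis i 1) - f z\<bar>) = 2 * half_variation i" for i
  proof -
    have "(\<Sum>\<^sub>\<infinity>z. \<bar>f (z + axis i 1) - f z\<bar>) = (\<Sum>\<^sub>\<infinity>z\<in>Z. \<bar>f (z + axis i 1) - f z\<bar>)"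
    proof (rule infsum_cong_neutral)
      fix z assume "z \<in> UNIV - Z"
      then have "f z = 0" "f (z + axis i 1) = 0" using outside_Z[of z] by (simp_all add: f_zero_iff)
      then show "\<bar>f (z + axis i 1) - f z\<bar> = 0" by simp
    qed auto
    then show ?thesis by (simp add: infsum_finite finite_Z half_variation_def)
  qed
  ultimately show ?thesis by (simp add: differential_l1_norm_eq_sum_partial)
qed

lemma ln_differential_eq:
  "ln (1 / (2 * real CARD('n)) * differential_l1_norm f) = ln (\<Sum>i\<in>UNIV. 1 / real CARD('n) * half_variation i)"
  by (simp add: differential_l1_norm_eq sum_distrib_left)

lemma cube_of_equality:
  assumes "(1 / real CARD('n) + 1 / p - 1) * - entropy UNIV
         = ln (\<Sum>i\<in>UNIV. 1 / real CARD('n) * half_variation i)"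
  shows "is_cube S" and "f = (\<lambda>z. real (card S) powr (- 1 / p) * indicator S z)"
proof -
  note eq = log_sobolev_half_variation(2)[OF assms]
  obtain a b c where ab: "\<And>i. a $ i \<le> b $ i" and S: "S = int_box a b"
    and c: "\<And>z. f z = c * indicator S z" "0 < c"
    using constant_on_box Han_equality_exchange eq by (metis (no_types, lifting))
  let ?l = "\<lambda>i. real_of_int (b $ i - a $ i + 1)"
  \<comment> \<open>Face times side is volume, so equal half variations will force equal
    sides.\<close>
  have P: "half_variation i * ?l i = c * (\<Prod>j\<in>UNIV. ?l j)" for i
    by (subst prod.remove[of UNIV i])
      (simp_all add: half_variation_box[OF ab S c] Compl_eq_Diff_UNIV del: of_int_add of_int_diff)
  fix k
  have "b $ i - a $ i + 1 = int (nat (b $ k - a $ k + 1))" for i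
  proof -
    have "half_variation i * ?l i = half_variation i * ?l k"
      using P[of i] P[of k] eq by metis
    then show ?thesis using half_variation_pos[of i] ab[of k] by simp
  qed
  moreover have "nat (b $ k - a $ k + 1) > 0" using ab[of k] by simp
  ultimately show "is_cube S" unfolding is_cube_iff_int_box using S by blast
  \<comment> \<open>Normalisation determines the constant \<open>c\<close>.\<close>
  have "card S * c powr p = 1" using mu_sum c by (simp add: f_pos)
  then have "c powr p = 1 / real (card S)" using S_nonempty finite_S by (simp add: field_simps)
  then have "(c powr p) powr (1 / p) = real (card S) powr (- 1 / p)"
    by (simp add: powr_minus_divide powr_divide)
  then have "c = real (card S) powr (- 1 / p)" using c(2) p_pos by (simp add: powr_powr)
  then show "f = (\<lambda>z. real (card S) powr (- 1 / p) * indicator S z)" using c(1) by auto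
qed

text \<open>For side \<open>m\<close> in dimension \<open>n\<close> the distribution is uniform on
  \<open>m ^ n\<close> points, and both sides come out as
  \<open>(n - 1 - n / p) * ln m\<close>.\<close>

lemma equality_of_cube:
  assumes "is_cube Q" and f: "f = (\<lambda>z. real (card Q) powr (- 1 / p) * indicator Q z)"
  shows "(1 / real CARD('n) + 1 / p - 1) * - entropy UNIV
         = ln (\<Sum>i\<in>UNIV. 1 / real CARD('n) * half_variation i)"
proof -
  obtain a b m where ab: "\<And>i. b $ i - a $ i + 1 = int m" "m > 0" and Q: "Q = int_box a b"
    using assms(1) unfolding is_cube_iff_int_box by blast
  let ?n = "CARD('n)"
  have card: "card Q = m ^ ?n" by (simp add: Q card_int_box ab)
  define c where "c = real (card Q) powr (- 1 / p)"
  have c: "c > 0" using ab(2) by (simp add: c_def card)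
  have f': "f z = c * indicator Q z" for z by (simp add: f c_def)
  have S: "S = Q" using c by (auto simp: S_def f' indicator_def split: if_splits)
  have ab': "a $ i \<le> b $ i" for i using ab(1)[of i] ab(2) by simp
  have hv: "half_variation i = c * real m ^ (?n - 1)" for i
    using half_variation_box[OF ab' S[unfolded Q] f'[folded S] c, of i]
    by (simp add: ab(1) Compl_eq_Diff_UNIV del: of_int_add of_int_diff)
  have mean: "(\<Sum>i\<in>UNIV. 1 / real ?n * half_variation i) = c * real m ^ (?n - 1)"
    by (simp add: hv)
  have ln_mean: "ln (c * real m ^ (?n - 1)) = ln (real (card Q)) * (- 1 / p) + (real ?n - 1) * ln (real m)"
    using c ab(2) by (simp add: ln_mult ln_realpow c_def ln_powr card of_nat_diff)
  have lnQ: "ln (real (card Q)) = real ?n * ln (real m)"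
    using ab(2) by (simp add: card ln_realpow)
  have ent: "entropy UNIV = ln (real (card Q))"
  proof -
    have "f z powr p = 1 / real (card Q)" if "z \<in> S" for z
    proof -
      have "c powr p = real (card Q) powr - 1" using p_pos by (simp add: c_def powr_powr)
      then show ?thesis using that ab(2) by (simp add: f' S card powr_neg_one)
    qed
    then have "entropy UNIV = - (\<Sum>z\<in>S. 1 / real (card Q) * ln (1 / real (card Q)))"
      unfolding entropy_def by (simp add: marginal_UNIV)
    also have "\<dots> = ln (real (card Q))" using ab(2) by (simp add: S[symmetric] ln_div)
    finally show ?thesis .
  qed
  show ?thesis unfolding mean ln_mean ent lnQ by (simp add: field_simps)
qed

end

theorem corollary1p3:
  fixes f :: "int ^ 'n \<Rightarrow> real" and p :: real
  assumes "CARD('n) \<ge> 2"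
    and "p > 0"
    and "f \<in> C\<^sub>0"
    and "\<And>z. f z \<ge> 0"
    and "lq_norm p f = 1"
  shows "(1 / real CARD('n) + 1 / p - 1) * (\<Sum>\<^sub>\<infinity>z. f z powr p * ln (f z powr p))
           \<le> ln (1 / (2 * real CARD('n)) * differential_l1_norm f)
       \<and> ((1 / real CARD('n) + 1 / p - 1) * (\<Sum>\<^sub>\<infinity>z. f z powr p * ln (f z powr p))
           = ln (1 / (2 * real CARD('n)) * differential_l1_norm f)
         \<longleftrightarrow> (\<exists>Q. is_cube Q \<and> f = (\<lambda>z. real (card Q) powr (- 1 / p) * indicator Q z)))"
proof -
  let ?S = "{z. 0 < f z}"
  have zero: "z \<notin> ?S \<longleftrightarrow> f z = 0" for z using assms(4)[of z] by auto
  have "{z. f z \<noteq> 0} = ?S" using zero by blast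
  then have fin: "finite ?S" using assms(3) by (simp add: finsupp_def)
  \<comment> \<open>Adding 1 makes the bound on support coordinates strict; the inserted
    \<open>0\<close> keeps the set under \<open>Max\<close> nonempty.\<close>
  define N where "N = Max (insert 0 ((\<lambda>(z, i). \<bar>z $ i\<bar>) ` (?S \<times> (UNIV :: 'n set)))) + 1"
  have "lattice_density f p N"
  proof
    show "0 < p" "\<And>z. 0 \<le> f z" by fact+
    fix z :: "int ^ 'n" and i assume N: "N \<le> \<bar>z $ i\<bar>"
    show "f z = 0"
    proof (rule ccontr)
      assume "f z \<noteq> 0"
      then have "(z, i) \<in> ?S \<times> UNIV" using zero by auto
      then have "\<bar>z $ i\<bar> \<in> insert 0 ((\<lambda>(z, i). \<bar>z $ i\<bar>) ` (?S \<times> (UNIV :: 'n set)))" by force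
      then have "\<bar>z $ i\<bar> \<le> N - 1" unfolding N_def using fin by (simp add: Max_ge)
      then show False using N by simp
    qed
  next
    have "(\<Sum>\<^sub>\<infinity>z. \<bar>f z\<bar> powr p) = (\<Sum>\<^sub>\<infinity>z\<in>?S. f z powr p)"
      using zero by (intro infsum_cong_neutral) auto
    then have "(\<Sum>z\<in>?S. f z powr p) powr (1 / p) = 1"
      using assms(5) fin by (simp add: lq_norm_def infsum_finite)
    then have "((\<Sum>z\<in>?S. f z powr p) powr (1 / p)) powr p = 1" by simp
    then show "(\<Sum>z\<in>?S. f z powr p) = 1" using assms(2) by (simp add: powr_powr sum_nonneg)
  qed
  then interpret lattice_density f p N .
  show ?thesis
    unfolding infsum_entropy ln_differential_eq
    using log_sobolev_half_variation(1) cube_of_equality equality_of_cube by blast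
qed

end
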